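(* Let $\alpha\in]0;1[$ and $\eta\in]0;1[$ be fixed constants, let $\sigma_0^2>0$, and let $\dot\Upsilon_A$ be the test of $H_0:\sigma^2=\sigma_0^2$ versus $H_1:\sigma^2>\sigma_0^2$ which rejects $H_0$ if $$\dot S_A\ \geq\ (1+\eta)\,\frac{\sigma_0^2}{n}\,q_{\chi^2_n,\,1-\alpha}+\left(\frac{\eta+1}{\eta}\right)\Delta K^2 .$$ Then the test $\dot\Upsilon_A$ has Type I error at most $\alpha$, i.e. $\mathbb{P}_{\sigma_0^2}(\dot\Upsilon_A\text{ rejects }H_0)\leq\alpha$, and therefore it is of level $\alpha$. Let $\beta\in]0;1[$ be a constant such that $1-\beta\geq\alpha$. For all $\sigma^2>0$ such that $$\sigma^2\ \geq\ \left(\frac{1+\eta}{1-\eta}\right)\frac{q_{\chi^2_n,\,1-\alpha}}{q_{\chi^2_n,\,\beta}}\,\sigma_0^2+\frac{2}{\eta(1-\eta)}\,\frac{n\Delta K^2}{q_{\chi^2_n,\,\beta}},$$ the test $\dot\Upsilon_A$ satisfies $\mathbb{P}_{\sigma^2}(\dot\Upsilon_A\text{ accepts }H_0)\leq\beta$ (the condition is asserted only to be sufficient).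
   Context: Consider a one-dimensional process $X$ solving the SDE $dX_t=b(X_t)\,dt+\sigma\,dW_t$, $X_0=x_0$, $t>0$, where the drift $b$ depends on the process, $\sigma$ is a constant diffusion coefficient and $W$ is a one-dimensional Brownian motion. The process is observed at times $i\Delta$, $i=0,\dots,n$, with fixed $\Delta>0$ and $n\Delta=T$. $\mathbb{P}_{\sigma^2}$ denotes the probability when the squared diffusion coefficient equals $\sigma^2$. Standing assumption: there exist a function $A:\mathbb{R}\times\mathbb{R}\to\mathbb{R}$ (possibly depending on parameters of the process and on $\Delta$; e.g. $A(x,y)=\Delta b(x)$ for the Euler–Maruyama scheme) and a constant $K$ depending on the function $b$ such that, for all $\Delta>0$, $$\left\|\max_{t\in[0,T]}\left|\int_t^{t+\Delta}b(X_s)\,ds-A(X_t,X_{t+\Delta})\right|\right\|_\infty\leq\Delta K,$$ where $\|\cdot\|_\infty$ is the essential supremum norm over the probability space; this holds with the same $A$ and $K$ for all values of $\sigma^2$ considered. For $i=1,\dots,n$ let $$\dot\xi_{i,A}=\frac{X_{i\Delta}-X_{(i-1)\Delta}-A(X_{(i-1)\Delta},X_{i\Delta})}{\sqrt\Delta},\qquad \dot S_A=\frac1n\sum_{i=1}^n\dot\xi_{i,A}^2 .$$ $q_{\chi^2_n,\beta}$ is the quantile of order $\beta$ of the central chi-squared distribution with $n$ degrees of freedom. A test accepts $H_0$ when it does not reject it; level $\alpha$ means that the probability of rejecting under $H_0$ is at most $\alpha$. *)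

theory Defs
  imports "HOL-Probability.Probability"
begin

definition brownian_motion :: "'a measure \<Rightarrow> (real \<Rightarrow> 'a \<Rightarrow> real) \<Rightarrow> bool" where
  "brownian_motion M W \<longleftrightarrow>
     prob_space M \<and>
     (\<forall>t\<ge>0. W t \<in> borel_measurable M) \<and>
     (AE \<omega> in M. W 0 \<omega> = 0) \<and>
     (\<forall>s t. 0 \<le> s \<and> s < t \<longrightarrow>
        distributed M lborel (\<lambda>\<omega>. W t \<omega> - W s \<omega>) (normal_density 0 (sqrt (t - s)))) \<and>
     (\<forall>(\<tau> :: nat \<Rightarrow> real) m. 0 \<le> \<tau> 0 \<and> (\<forall>i<m. \<tau> i \<le> \<tau> (Suc i)) \<longrightarrow>
        prob_space.indep_vars M (\<lambda>_. borel) (\<lambda>i \<omega>. W (\<tau> (Suc i)) \<omega> - W (\<tau> i) \<omega>) {..<m}) \<and>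
     (AE \<omega> in M. continuous_on {0..} (\<lambda>t. W t \<omega>))"

text \<open>
  The equation \<open>dX = b(X) dt + \<sigma> dW\<close>, \<open>X\<^sub>0 = x\<^sub>0\<close>, in integrated form.  As \<open>\<sigma>\<close> is constant,
  its stochastic integral is \<open>\<sigma> W\<^sub>t\<close> and no filtration is needed.
\<close>

definition solves_sde ::
  "'a measure \<Rightarrow> (real \<Rightarrow> 'a \<Rightarrow> real) \<Rightarrow> (real \<Rightarrow> real) \<Rightarrow> real \<Rightarrow> real \<Rightarrow> (real \<Rightarrow> 'a \<Rightarrow> real) \<Rightarrow> bool" where
  "solves_sde M W b \<sigma> x0 X \<longleftrightarrow>
     (\<forall>t\<ge>0. X t \<in> borel_measurable M) \<and>
     (AE \<omega> in M. continuous_on {0..} (\<lambda>t. X t \<omega>)) \<and>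
     (AE \<omega> in M. \<forall>t\<ge>0. set_integrable lborel {0..t} (\<lambda>s. b (X s \<omega>))) \<and>
     (AE \<omega> in M. \<forall>t\<ge>0. X t \<omega> = x0 + (LINT s:{0..t}|lborel. b (X s \<omega>)) + \<sigma> * W t \<omega>)"

text \<open>
  \<open>X\<close> has squared diffusion coefficient \<open>v\<close> under \<open>M\<close>; the sign of \<open>\<sigma>\<close> and the driving
  Brownian motion are left free.
\<close>

definition diffusion_law ::
  "'a measure \<Rightarrow> (real \<Rightarrow> real) \<Rightarrow> real \<Rightarrow> (real \<Rightarrow> 'a \<Rightarrow> real) \<Rightarrow> real \<Rightarrow> bool" where
  "diffusion_law M b x0 X v \<longleftrightarrow>
     (\<exists>\<sigma> W. \<sigma>\<^sup>2 = v \<and> brownian_motion M W \<and> solves_sde M W b \<sigma> x0 X)"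

text \<open>
  The first argument of \<open>A\<close> is the time step, on which the approximation may depend.
  \<^const>\<open>esssup\<close> is \<open>\<infinity>\<close> on non-measurable functions, so the bound includes measurability
  of the supremum over \<open>t\<close>.
\<close>

definition drift_approx ::
  "'a measure \<Rightarrow> (real \<Rightarrow> 'a \<Rightarrow> real) \<Rightarrow> (real \<Rightarrow> real) \<Rightarrow> real \<Rightarrow> (real \<Rightarrow> real \<Rightarrow> real \<Rightarrow> real) \<Rightarrow> real \<Rightarrow> bool" where
  "drift_approx M X b T A K \<longleftrightarrow>
     (\<forall>\<delta>>0. esssup M (\<lambda>\<omega>. SUP t\<in>{0..T}.
         ereal \<bar>(LINT s:{t..t+\<delta>}|lborel. b (X s \<omega>)) - A \<delta> (X t \<omega>) (X (t + \<delta>) \<omega>)\<bar>)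
       \<le> ereal (\<delta> * K))"

definition xi_dot ::
  "(real \<Rightarrow> 'a \<Rightarrow> real) \<Rightarrow> (real \<Rightarrow> real \<Rightarrow> real \<Rightarrow> real) \<Rightarrow> real \<Rightarrow> nat \<Rightarrow> 'a \<Rightarrow> real" where
  "xi_dot X A \<Delta> i \<omega> =
     (X (real i * \<Delta>) \<omega> - X ((real i - 1) * \<Delta>) \<omega>
        - A \<Delta> (X ((real i - 1) * \<Delta>) \<omega>) (X (real i * \<Delta>) \<omega>)) / sqrt \<Delta>"

definition S_dot ::
  "(real \<Rightarrow> 'a \<Rightarrow> real) \<Rightarrow> (real \<Rightarrow> real \<Rightarrow> real \<Rightarrow> real) \<Rightarrow> real \<Rightarrow> nat \<Rightarrow> 'a \<Rightarrow> real" where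
  "S_dot X A \<Delta> n \<omega> = (\<Sum>i=1..n. (xi_dot X A \<Delta> i \<omega>)\<^sup>2) / real n"

definition chi_squared :: "nat \<Rightarrow> real measure" where
  "chi_squared n =
     distr (PiM {..<n} (\<lambda>_. density lborel std_normal_density)) borel (\<lambda>x. \<Sum>i<n. (x i)\<^sup>2)"

definition quantile :: "real measure \<Rightarrow> real \<Rightarrow> real" where
  "quantile M p = Inf {x. p \<le> cdf M x}"

abbreviation q_chi2 :: "nat \<Rightarrow> real \<Rightarrow> real" where
  "q_chi2 n p \<equiv> quantile (chi_squared n) p"

text \<open>\<open>v0\<close> is the squared diffusion coefficient under the null hypothesis.\<close>

definition Upsilon_rejects ::
  "(real \<Rightarrow> 'a \<Rightarrow> real) \<Rightarrow> (real \<Rightarrow> real \<Rightarrow> real \<Rightarrow> real) \<Rightarrow> real \<Rightarrow> nat \<Rightarrow> real \<Rightarrow> real \<Rightarrow> real \<Rightarrow> real \<Rightarrow> 'a \<Rightarrow> bool" where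
  "Upsilon_rejects X A \<Delta> n K v0 \<alpha> \<eta> \<omega> \<longleftrightarrow>
     S_dot X A \<Delta> n \<omega> \<ge>
       (1 + \<eta>) * (v0 / real n) * q_chi2 n (1 - \<alpha>) + ((\<eta> + 1) / \<eta>) * \<Delta> * K\<^sup>2"

definition of_level ::
  "(real \<Rightarrow> 'a measure) \<Rightarrow> real set \<Rightarrow> ('a \<Rightarrow> bool) \<Rightarrow> real \<Rightarrow> bool" where
  "of_level P H0 rejects \<alpha> \<longleftrightarrow> (\<forall>v\<in>H0. measure (P v) {\<omega> \<in> space (P v). rejects \<omega>} \<le> \<alpha>)"

end

theory Submission
  imports Defs
begin

text \<open>
  The equation gives \<open>\<xi>\<^sub>i = \<sigma> Z\<^sub>i + r\<^sub>i\<close> with independent standard normal \<open>Z\<^sub>i\<close> and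
  \<open>r\<^sub>i\<^sup>2 \<le> \<Delta> K\<^sup>2\<close>.  With \<open>Q = \<Sum>Z\<^sub>i\<^sup>2\<close>, Young's inequality with weight \<open>\<eta>\<close> places \<open>S\<close> between
  \<open>(1 - \<eta>) \<sigma>\<^sup>2 Q / n\<close> and \<open>(1 + \<eta>) \<sigma>\<^sup>2 Q / n\<close> up to multiples of \<open>\<Delta> K\<^sup>2\<close>.  Hence rejecting
  forces the chi-squared variable \<open>Q\<close> above its quantile of order \<open>1 - \<alpha>\<close>, and accepting forces
  it below its quantile of order \<open>\<beta>\<close>; as the chi-squared law has no atoms, strictness is immaterial.
  The rejection event need not be measurable, since \<open>A\<close> is arbitrary; a non-measurable
  set has \<^const>\<open>measure\<close> \<open>0\<close>, so almost sure inclusion in a measurable set suffices.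
\<close>

subsection \<open>Quantiles\<close>

context real_distribution
begin

text \<open>An \<open>Inf\<close> of reals obeys its usual laws only on nonempty sets bounded below.
  Both properties come from the limits 1 and 0 of the cdf at the two infinities, which is where 0 <
  \<open>p\<close> < 1 enters.\<close>

lemma quantile_set:
  assumes "0 < p" "p < 1"
  shows "{x. p \<le> cdf M x} \<noteq> {}" "bdd_below {x. p \<le> cdf M x}"
proof -
  have "eventually (\<lambda>x. p < cdf M x) at_top"
    using order_tendstoD(1)[OF cdf_lim_at_top_prob] assms by simp
  then obtain u where "p < cdf M u"
    by (meson eventually_happens trivial_limit_at_top_linorder)
  then show "{x. p \<le> cdf M x} \<noteq> {}"
    by (auto intro: less_imp_le)
  have "eventually (\<lambda>x. cdf M x < p) at_bot"
    using order_tendstoD(2)[OF cdf_lim_at_bot] assms by simp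
  then obtain l where "\<And>x. x \<le> l \<Longrightarrow> cdf M x < p"
    by (auto simp: eventually_at_bot_linorder)
  then show "bdd_below {x. p \<le> cdf M x}"
    by (intro bdd_belowI[of _ l]) (meson linear mem_Collect_eq not_less)
qed

lemma cdf_less_of_less_quantile:
  assumes "0 < p" "p < 1" "x < quantile M p"
  shows "cdf M x < p"
proof (rule ccontr)
  assume "\<not> cdf M x < p"
  then have "quantile M p \<le> x"
    unfolding quantile_def using quantile_set[OF assms(1,2)] by (intro cInf_lower) auto
  with assms show False by simp
qed

text \<open>Points right of the infimum lie above some member of the set, so the cdf is at least
  \<open>p\<close> there; right-continuity carries this bound to the quantile itself.\<close>

lemma le_cdf_quantile:
  assumes "0 < p" "p < 1"
  shows "p \<le> cdf M (quantile M p)"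
proof (rule tendsto_lowerbound)
  show "(cdf M \<longlongrightarrow> cdf M (quantile M p)) (at_right (quantile M p))"
    using cdf_is_right_cont by (simp add: continuous_within)
  have "p \<le> cdf M x" if x: "quantile M p < x" for x
  proof -
    obtain y where "p \<le> cdf M y" "y < x"
      using cInf_lessD[OF quantile_set(1)[OF assms] x[unfolded quantile_def]] by auto
    then show ?thesis
      using cdf_nondecreasing[of y x] by simp
  qed
  then show "eventually (\<lambda>x. p \<le> cdf M x) (at_right (quantile M p))"
    by (rule eventually_mono[OF eventually_at_right_less])
qed simp

text \<open>The mass of the open half-line is the left limit of the cdf, and the cdf stays below
  \<open>p\<close> left of the quantile.\<close>

lemma measure_lessThan_quantile_le:
  assumes "0 < p" "p < 1"
  shows "measure M {..<quantile M p} \<le> p"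
proof (rule tendsto_upperbound)
  show "(cdf M \<longlongrightarrow> measure M {..<quantile M p}) (at_left (quantile M p))"
    by (rule cdf_at_left)
  show "eventually (\<lambda>x. cdf M x \<le> p) (at_left (quantile M p))"
    unfolding eventually_at_filter
    by (intro always_eventually) (auto intro: less_imp_le cdf_less_of_less_quantile[OF assms])
qed simp

text \<open>An atom at the quantile would count towards the closed upper half-line. Without one, the
  open lower half-line already carries mass at least \<open>p\<close>, and the complement gives the
  bound.\<close>

lemma measure_atLeast_quantile_le:
  assumes "0 < p" "p < 1" "measure M {quantile M p} = 0"
  shows "measure M {quantile M p..} \<le> 1 - p"
proof -
  have "measure M {..<quantile M p} + measure M {quantile M p} = measure M {..quantile M p}"
    by (subst finite_measure_Union[symmetric]) (auto intro: arg_cong[where f = "measure M"])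
  then have "p \<le> measure M {..<quantile M p}"
    using le_cdf_quantile[OF assms(1,2)] assms(3) by (simp add: cdf_def)
  moreover have "measure M {quantile M p..} = 1 - measure M {..<quantile M p}"
    by (subst prob_compl[symmetric]) (auto intro!: arg_cong[where f = "measure M"])
  ultimately show ?thesis by simp
qed

end

subsection \<open>The chi-squared distribution\<close>

lemma prob_space_std_normal: "prob_space (density lborel std_normal_density)"
  by (rule prob_space_normal_density) simp

text \<open>Lets the measurability prover treat the Gaussian product space as a product of Borel
  spaces.\<close>

lemma sets_PiM_std_normal [measurable_cong]:
  "sets (PiM I (\<lambda>_. density lborel std_normal_density)) = sets (PiM I (\<lambda>_. borel :: real measure))"
  by (rule sets_PiM_cong) auto

lemma real_distribution_chi_squared: "real_distribution (chi_squared n)"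
proof -
  interpret prob_space "PiM {..<n} (\<lambda>_. density lborel std_normal_density)"
    by (intro prob_space_PiM prob_space_std_normal)
  show ?thesis
    unfolding chi_squared_def by (rule real_distribution_distr) measurable
qed

text \<open>Fubini in the last coordinate: once the others are fixed, at most two values of it make
  the sum of squares equal to \<open>c\<close>, a Lebesgue null set. For \<open>n\<close> = 0 the
  law is the point mass at 0, hence \<open>n \<ge> 1\<close>.\<close>

lemma measure_chi_squared_singleton:
  assumes "n \<ge> 1"
  shows "measure (chi_squared n) {c} = 0"
proof -
  let ?N = "density lborel std_normal_density"
  obtain m where n: "n = Suc m" using assms by (cases n) auto
  interpret product_sigma_finite "\<lambda>_::nat. ?N"
    by (simp add: product_sigma_finite_def prob_space_imp_sigma_finite prob_space_std_normal)
  let ?f = "\<lambda>x::nat \<Rightarrow> real. indicator {c} (\<Sum>i<n. (x i)\<^sup>2) :: ennreal"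
  have "emeasure (chi_squared n) {c} = (\<integral>\<^sup>+x. indicator {c} x \<partial>chi_squared n)"
    by (simp add: chi_squared_def)
  also have "\<dots> = (\<integral>\<^sup>+x. ?f x \<partial>PiM {..<n} (\<lambda>_. ?N))"
    unfolding chi_squared_def by (subst nn_integral_distr) auto
  also have "\<dots> = (\<integral>\<^sup>+x. (\<integral>\<^sup>+y. ?f (x(m := y)) \<partial>?N) \<partial>PiM {..<m} (\<lambda>_. ?N))"
    unfolding n lessThan_Suc by (rule product_nn_integral_insert) auto
  also have "\<dots> = 0"
  proof -
    have "(\<integral>\<^sup>+y. ?f (x(m := y)) \<partial>?N) = 0" for x :: "nat \<Rightarrow> real"
    proof -
      \<comment> \<open>The last square has to equal \<open>d\<close>. If \<open>d\<close> < 0 this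
        is impossible; \<open>sqrt d\<close> is then still some real number, and excluding it and
        its negative is harmless.\<close>
      define d where "d = c - (\<Sum>i<m. (x i)\<^sup>2)"
      have "?f (x(m := y)) = 0" if "y \<noteq> sqrt d" "y \<noteq> - sqrt d" for y
        using that by (auto simp: n d_def indicator_def real_sqrt_abs abs_if split: if_splits)
      moreover have "AE y in lborel. y \<noteq> sqrt d \<and> y \<noteq> - sqrt d"
        using AE_lborel_singleton[of "sqrt d"] AE_lborel_singleton[of "- sqrt d"] by auto
      ultimately have "AE y in ?N. ?f (x(m := y)) = 0"
        by (subst AE_density) auto
      moreover have "(\<lambda>y. ?f (x(m := y))) \<in> borel_measurable ?N"
      proof -
        have "(\<lambda>y. \<Sum>i<n. ((x(m := y)) i)\<^sup>2) = (\<lambda>y. (\<Sum>i<m. (x i)\<^sup>2) + y\<^sup>2)"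
          by (auto simp: n)
        then show ?thesis by (subst measurable_density_eq1) simp
      qed
      ultimately show ?thesis
        by (subst nn_integral_0_iff_AE) auto
    qed
    then show ?thesis by simp
  qed
  finally show ?thesis by (simp add: measure_def)
qed

text \<open>Allows clearing the denominators \<open>q_chi2 n \<beta>\<close> later. Negative values
  have no mass because the variable is a sum of squares, and 0 has none for lack of atoms, so the
  cdf vanishes at 0.\<close>

lemma q_chi2_pos:
  assumes "n \<ge> 1" "0 < p" "p < 1"
  shows "0 < q_chi2 n p"
proof (rule ccontr)
  interpret real_distribution "chi_squared n" by (rule real_distribution_chi_squared)
  assume "\<not> 0 < q_chi2 n p"
  then have "p \<le> cdf (chi_squared n) 0"
    using le_cdf_quantile[OF assms(2,3)] cdf_nondecreasing[of "q_chi2 n p" 0] by simp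
  also have "\<dots> = measure (chi_squared n) {..<0} + measure (chi_squared n) {0}"
    unfolding cdf_def
    by (subst finite_measure_Union[symmetric]) (auto intro: arg_cong[where f = "measure _"])
  also have "\<dots> = measure (chi_squared n) {..<0}"
    by (simp add: measure_chi_squared_singleton[OF assms(1)])
  also have "\<dots> = 0"
  proof -
    have "\<not> (\<Sum>i<n. (x i)\<^sup>2) < 0" for x :: "nat \<Rightarrow> real"
      by (simp add: not_less sum_nonneg)
    then have "(\<lambda>x::nat \<Rightarrow> real. \<Sum>i<n. (x i)\<^sup>2) -` {..<0} = {}"
      by auto
    then show ?thesis
      unfolding chi_squared_def by (subst measure_distr) auto
  qed
  finally show False using assms by simp
qed

subsection \<open>Reduction to Gaussian increments\<close>

text \<open>Division by \<open>sqrt \<Delta>\<close> makes each increment standard normal, and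
  independence makes their joint law the product measure whose image under the sum of squares
  defines \<open>chi_squared\<close>.\<close>

lemma chi_squared_brownian_increments:
  assumes W: "brownian_motion M W" and "\<Delta> > 0" "n \<ge> 1"
  defines "Z \<equiv> (\<lambda>i \<omega>. (W (real (Suc i) * \<Delta>) \<omega> - W (real i * \<Delta>) \<omega>) / sqrt \<Delta>)"
  shows "(\<lambda>\<omega>. \<Sum>i<n. (Z i \<omega>)\<^sup>2) \<in> borel_measurable M"
    and "distr M borel (\<lambda>\<omega>. \<Sum>i<n. (Z i \<omega>)\<^sup>2) = chi_squared n"
proof -
  interpret prob_space M using W by (simp add: brownian_motion_def)
  have [measurable]: "W t \<in> borel_measurable M" if "t \<ge> 0" for t
    using W that unfolding brownian_motion_def by blast
  have Z [measurable]: "Z i \<in> borel_measurable M" for i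
    unfolding Z_def using \<open>\<Delta> > 0\<close> by (intro borel_measurable_divide borel_measurable_diff) auto
  then show "(\<lambda>\<omega>. \<Sum>i<n. (Z i \<omega>)\<^sup>2) \<in> borel_measurable M" by simp
  have "indep_vars (\<lambda>_. borel) (\<lambda>i \<omega>. W (real (Suc i) * \<Delta>) \<omega> - W (real i * \<Delta>) \<omega>) {..<n}"
  proof -
    \<comment> \<open>Keeping \<open>real 0 * \<Delta>\<close> unsimplified lets unification read
      off the grid \<open>\<tau> i = real i * \<Delta>\<close>.\<close>
    have order: "0 \<le> real 0 * \<Delta> \<and> (\<forall>i<n. real i * \<Delta> \<le> real (Suc i) * \<Delta>)"
      using \<open>\<Delta> > 0\<close> by (auto intro!: mult_right_mono)
    have "indep_vars (\<lambda>_. borel) (\<lambda>i \<omega>. W (\<tau> (Suc i)) \<omega> - W (\<tau> i) \<omega>) {..<n}"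
      if "0 \<le> \<tau> 0 \<and> (\<forall>i<n. \<tau> i \<le> \<tau> (Suc i))" for \<tau> :: "nat \<Rightarrow> real"
      using W that unfolding brownian_motion_def by blast
    from this[OF order] show ?thesis .
  qed
  then have "indep_vars (\<lambda>_. borel) Z {..<n}"
    unfolding Z_def by (rule indep_vars_compose2) auto
  then have joint: "distr M (\<Pi>\<^sub>M i\<in>{..<n}. borel) (\<lambda>\<omega>. \<lambda>i\<in>{..<n}. Z i \<omega>)
      = (\<Pi>\<^sub>M i\<in>{..<n}. distr M borel (Z i))"
    using \<open>n \<ge> 1\<close> by (subst (asm) indep_vars_iff_distr_eq_PiM) (auto simp: lessThan_empty_iff)
  have "distr M borel (Z i) = density lborel std_normal_density" for i
  proof -
    have "distributed M lborel (\<lambda>\<omega>. W t \<omega> - W s \<omega>) (normal_density 0 (sqrt (t - s)))"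
      if "0 \<le> s" "s < t" for s t
      using W that unfolding brownian_motion_def by blast
    from this[of "real i * \<Delta>" "real (Suc i) * \<Delta>"]
    have "distributed M lborel (\<lambda>\<omega>. W (real (Suc i) * \<Delta>) \<omega> - W (real i * \<Delta>) \<omega>)
        (normal_density 0 (sqrt (real (Suc i) * \<Delta> - real i * \<Delta>)))"
      using \<open>\<Delta> > 0\<close> by simp
    moreover have "real (Suc i) * \<Delta> - real i * \<Delta> = \<Delta>"
      by (simp add: algebra_simps)
    ultimately have "distributed M lborel (\<lambda>\<omega>. W (real (Suc i) * \<Delta>) \<omega> - W (real i * \<Delta>) \<omega>)
        (normal_density 0 (sqrt \<Delta>))"
      by simp
    then have "distributed M lborel (Z i) std_normal_density"
      using \<open>\<Delta> > 0\<close> by (subst (asm) normal_standard_normal_convert) (auto simp: Z_def)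
    then have "distr M lborel (Z i) = density lborel std_normal_density"
      by (simp add: distributed_def)
    moreover have "distr M lborel (Z i) = distr M borel (Z i)"
      by (rule distr_cong) auto
    ultimately show ?thesis by simp
  qed
  with joint have "chi_squared n = distr (distr M (\<Pi>\<^sub>M i\<in>{..<n}. borel) (\<lambda>\<omega>. \<lambda>i\<in>{..<n}. Z i \<omega>))
      borel (\<lambda>x. \<Sum>i<n. (x i)\<^sup>2)"
    by (simp add: chi_squared_def)
  also have "\<dots> = distr M borel (\<lambda>\<omega>. \<Sum>i<n. (Z i \<omega>)\<^sup>2)"
    by (subst distr_distr) (auto simp: comp_def intro!: distr_cong)
  finally show "distr M borel (\<lambda>\<omega>. \<Sum>i<n. (Z i \<omega>)\<^sup>2) = chi_squared n" by simp
qed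

text \<open>The intervals [0, t] and [t, t + d] overlap only in the null set {t}, so the drift
  integral is additive; the initial value cancels.\<close>

lemma sde_increment:
  assumes X: "\<And>t. t \<ge> 0 \<Longrightarrow> x t = x0 + (LINT s:{0..t}|lborel. g s) + w t"
    and g: "\<And>t. t \<ge> 0 \<Longrightarrow> set_integrable lborel {0..t} (g :: real \<Rightarrow> real)"
    and "0 \<le> t" "0 \<le> d"
  shows "x (t + d) - x t = (LINT s:{t..t + d}|lborel. g s) + (w (t + d) - w t)"
proof -
  have "(LINT s:{0..t} \<union> {t..t + d}|lborel. g s)
      = (LINT s:{0..t}|lborel. g s) + (LINT s:{t..t + d}|lborel. g s)"
  proof (rule set_integral_Un_AE)
    show "AE s in lborel. \<not> (s \<in> {0..t} \<and> s \<in> {t..t + d})"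
      using AE_lborel_singleton[of t] by eventually_elim auto
    show "set_integrable lborel {t..t + d} g"
      by (rule set_integrable_subset[OF g[of "t + d"]]) (use assms in auto)
  qed (use assms in auto)
  moreover have "{0..t} \<union> {t..t + d} = {0..t + d}" using assms by auto
  ultimately show ?thesis using X[of t] X[of "t + d"] assms by simp
qed

text \<open>Expanding \<open>(\<eta> * a - r)\<^sup>2 / \<eta> \<ge> 0\<close> and its counterpart
  with \<open>+ r\<close> bounds the cross term \<open>2 * a * r\<close> from both sides.\<close>

lemma young_sq:
  fixes a r \<eta> :: real
  assumes "0 < \<eta>"
  shows "(a + r)\<^sup>2 \<le> (1 + \<eta>) * a\<^sup>2 + (1 + 1 / \<eta>) * r\<^sup>2"
    and "(1 - \<eta>) * a\<^sup>2 - (1 / \<eta> - 1) * r\<^sup>2 \<le> (a + r)\<^sup>2"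
proof -
  have "0 \<le> (\<eta> * a - r)\<^sup>2 / \<eta>" "0 \<le> (\<eta> * a + r)\<^sup>2 / \<eta>"
    using assms by auto
  then have "2 * a * r \<le> \<eta> * a\<^sup>2 + r\<^sup>2 / \<eta>" "- 2 * a * r \<le> \<eta> * a\<^sup>2 + r\<^sup>2 / \<eta>"
    using assms by (auto simp: power2_eq_square field_simps)
  then show "(a + r)\<^sup>2 \<le> (1 + \<eta>) * a\<^sup>2 + (1 + 1 / \<eta>) * r\<^sup>2"
    "(1 - \<eta>) * a\<^sup>2 - (1 / \<eta> - 1) * r\<^sup>2 \<le> (a + r)\<^sup>2"
    by (simp_all add: power2_eq_square algebra_simps)
qed

text \<open>The remainder \<open>r\<close> is the drift error divided by
  \<open>sqrt \<Delta>\<close>. The error bound is uniform in \<open>t\<close> and the integral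
  equation holds for all \<open>t\<close> off one null set, so all \<open>i\<close> are handled
  simultaneously.\<close>

lemma AE_xi_dot_decomposition:
  assumes "solves_sde M W b \<sigma> x0 X" and approx: "drift_approx M X b T A K"
    and "\<Delta> > 0" "real n * \<Delta> = T"
  shows "AE \<omega> in M. \<forall>i<n. \<exists>r. r\<^sup>2 \<le> \<Delta> * K\<^sup>2 \<and>
    xi_dot X A \<Delta> (Suc i) \<omega> = \<sigma> * ((W (real (Suc i) * \<Delta>) \<omega> - W (real i * \<Delta>) \<omega>) / sqrt \<Delta>) + r"
proof -
  have "esssup M (\<lambda>\<omega>. SUP t\<in>{0..T}.
         ereal \<bar>(LINT s:{t..t+\<Delta>}|lborel. b (X s \<omega>)) - A \<Delta> (X t \<omega>) (X (t + \<Delta>) \<omega>)\<bar>) \<le> ereal (\<Delta> * K)"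
    using approx \<open>\<Delta> > 0\<close> by (simp add: drift_approx_def)
  then have "AE \<omega> in M. (SUP t\<in>{0..T}.
         ereal \<bar>(LINT s:{t..t+\<Delta>}|lborel. b (X s \<omega>)) - A \<Delta> (X t \<omega>) (X (t + \<Delta>) \<omega>)\<bar>) \<le> ereal (\<Delta> * K)"
    \<comment> \<open>\<open>esssup_AE\<close> asks for no measurability, since the essential
      supremum is infinite on non-measurable functions.\<close>
    by (intro eventually_mono[OF esssup_AE[of _ M]]) (rule order_trans)
  moreover have "AE \<omega> in M. \<forall>t\<ge>0. set_integrable lborel {0..t} (\<lambda>s. b (X s \<omega>))"
    and "AE \<omega> in M. \<forall>t\<ge>0. X t \<omega> = x0 + (LINT s:{0..t}|lborel. b (X s \<omega>)) + \<sigma> * W t \<omega>"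
    using assms(1) by (auto simp: solves_sde_def)
  ultimately show ?thesis
  proof eventually_elim
    case (elim \<omega>)
    show ?case
    proof (intro allI impI)
      fix i assume "i < n"
      define t where "t = real i * \<Delta>"
      have t: "0 \<le> t" "t \<in> {0..T}" "real (Suc i) * \<Delta> = t + \<Delta>"
        using \<open>i < n\<close> \<open>\<Delta> > 0\<close> assms(4) by (auto simp: t_def algebra_simps mult_right_mono)
      define e where "e = (LINT s:{t..t+\<Delta>}|lborel. b (X s \<omega>)) - A \<Delta> (X t \<omega>) (X (t + \<Delta>) \<omega>)"
      have "ereal \<bar>e\<bar> \<le> ereal (\<Delta> * K)"
        unfolding e_def by (rule order_trans[OF SUP_upper elim(1)]) (rule t(2))
      then have "e\<^sup>2 \<le> (\<Delta> * K)\<^sup>2"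
        using power_mono[of "\<bar>e\<bar>" "\<Delta> * K" 2] by simp
      then have "(e / sqrt \<Delta>)\<^sup>2 \<le> \<Delta> * K\<^sup>2"
        using \<open>\<Delta> > 0\<close> by (simp add: power_divide field_simps power2_eq_square)
      moreover have "X (t + \<Delta>) \<omega> - X t \<omega>
          = (LINT s:{t..t + \<Delta>}|lborel. b (X s \<omega>)) + (\<sigma> * W (t + \<Delta>) \<omega> - \<sigma> * W t \<omega>)"
        by (rule sde_increment[where x = "\<lambda>t. X t \<omega>" and w = "\<lambda>t. \<sigma> * W t \<omega>",
              OF elim(3)[rule_format] elim(2)[rule_format] t(1) less_imp_le[OF \<open>\<Delta> > 0\<close>]])
      then have "X (t + \<Delta>) \<omega> - X t \<omega> - A \<Delta> (X t \<omega>) (X (t + \<Delta>) \<omega>)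
          = \<sigma> * (W (t + \<Delta>) \<omega> - W t \<omega>) + e"
        by (simp add: e_def right_diff_distrib)
      then have "xi_dot X A \<Delta> (Suc i) \<omega> = (\<sigma> * (W (t + \<Delta>) \<omega> - W t \<omega>) + e) / sqrt \<Delta>"
        unfolding xi_dot_def t(3) by (simp flip: t_def)
      then have "xi_dot X A \<Delta> (Suc i) \<omega>
          = \<sigma> * ((W (real (Suc i) * \<Delta>) \<omega> - W (real i * \<Delta>) \<omega>) / sqrt \<Delta>) + e / sqrt \<Delta>"
        unfolding t(3) t_def[symmetric] by (simp only: add_divide_distrib times_divide_eq_right)
      ultimately show "\<exists>r. r\<^sup>2 \<le> \<Delta> * K\<^sup>2 \<and> xi_dot X A \<Delta> (Suc i) \<omega>
          = \<sigma> * ((W (real (Suc i) * \<Delta>) \<omega> - W (real i * \<Delta>) \<omega>) / sqrt \<Delta>) + r"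
        by blast
    qed
  qed
qed

text \<open>Averages \<open>young_sq\<close> over \<open>i\<close> with
  \<open>a = \<sigma> * Z i \<omega>\<close>. Only \<open>\<sigma>\<^sup>2 = v\<close> survives the
  squaring, so the sign of \<sigma> does not matter.\<close>

lemma S_dot_chi_squared_bounds:
  assumes "diffusion_law M b x0 X v" "drift_approx M X b T A K"
    and "\<Delta> > 0" "real n * \<Delta> = T" "n \<ge> 1" "0 < \<eta>" "\<eta> < 1"
  obtains Q where "Q \<in> borel_measurable M" "distr M borel Q = chi_squared n"
    "AE \<omega> in M. S_dot X A \<Delta> n \<omega> \<le> (1 + \<eta>) * (v / real n) * Q \<omega> + (1 + 1 / \<eta>) * (\<Delta> * K\<^sup>2)"
    "AE \<omega> in M. (1 - \<eta>) * (v / real n) * Q \<omega> - (1 / \<eta> - 1) * (\<Delta> * K\<^sup>2) \<le> S_dot X A \<Delta> n \<omega>"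
proof -
  obtain \<sigma> W where \<sigma>: "\<sigma>\<^sup>2 = v" and W: "brownian_motion M W" and sde: "solves_sde M W b \<sigma> x0 X"
    using assms(1) by (auto simp: diffusion_law_def)
  define Z where "Z = (\<lambda>i \<omega>. (W (real (Suc i) * \<Delta>) \<omega> - W (real i * \<Delta>) \<omega>) / sqrt \<Delta>)"
  define Q where "Q = (\<lambda>\<omega>. \<Sum>i<n. (Z i \<omega>)\<^sup>2)"
  have Q: "Q \<in> borel_measurable M" "distr M borel Q = chi_squared n"
    unfolding Q_def Z_def using chi_squared_brownian_increments[OF W assms(3,5)] .
  \<comment> \<open>Shifts the observation index 1..n to 0..n-1, the index range of the increments
    \<open>Z\<close>.\<close>
  have S: "S_dot X A \<Delta> n \<omega> = (\<Sum>i<n. (xi_dot X A \<Delta> (Suc i) \<omega>)\<^sup>2) / real n" for \<omega>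
    by (simp add: S_dot_def sum.atLeast1_atMost_eq lessThan_Suc_atMost)
  have "AE \<omega> in M. \<forall>i<n. \<exists>r. r\<^sup>2 \<le> \<Delta> * K\<^sup>2 \<and> xi_dot X A \<Delta> (Suc i) \<omega> = \<sigma> * Z i \<omega> + r"
    using AE_xi_dot_decomposition[OF sde assms(2-4)] by (simp add: Z_def)
  then have "AE \<omega> in M.
      S_dot X A \<Delta> n \<omega> \<le> (1 + \<eta>) * (v / real n) * Q \<omega> + (1 + 1 / \<eta>) * (\<Delta> * K\<^sup>2) \<and>
      (1 - \<eta>) * (v / real n) * Q \<omega> - (1 / \<eta> - 1) * (\<Delta> * K\<^sup>2) \<le> S_dot X A \<Delta> n \<omega>"
  proof eventually_elim
    case (elim \<omega>)
    let ?x = "\<lambda>i. (xi_dot X A \<Delta> (Suc i) \<omega>)\<^sup>2"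
    have bounds: "?x i \<le> (1 + \<eta>) * v * (Z i \<omega>)\<^sup>2 + (1 + 1 / \<eta>) * (\<Delta> * K\<^sup>2)"
      "(1 - \<eta>) * v * (Z i \<omega>)\<^sup>2 - (1 / \<eta> - 1) * (\<Delta> * K\<^sup>2) \<le> ?x i" if i: "i < n" for i
    proof -
      obtain r where r: "r\<^sup>2 \<le> \<Delta> * K\<^sup>2" "xi_dot X A \<Delta> (Suc i) \<omega> = \<sigma> * Z i \<omega> + r"
        using elim i by blast
      \<comment> \<open>The factor \<open>1 / \<eta> - 1\<close> is nonnegative because \<eta> <
        1.\<close>
      have "(1 + 1 / \<eta>) * r\<^sup>2 \<le> (1 + 1 / \<eta>) * (\<Delta> * K\<^sup>2)"
        "(1 / \<eta> - 1) * r\<^sup>2 \<le> (1 / \<eta> - 1) * (\<Delta> * K\<^sup>2)"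
        using r(1) assms(6,7) by (auto intro!: mult_left_mono)
      then show "?x i \<le> (1 + \<eta>) * v * (Z i \<omega>)\<^sup>2 + (1 + 1 / \<eta>) * (\<Delta> * K\<^sup>2)"
        "(1 - \<eta>) * v * (Z i \<omega>)\<^sup>2 - (1 / \<eta> - 1) * (\<Delta> * K\<^sup>2) \<le> ?x i"
        using young_sq[OF assms(6), of "\<sigma> * Z i \<omega>" r]
        by (auto simp: r(2) power_mult_distrib \<sigma> mult.assoc)
    qed
    have "(\<Sum>i<n. ?x i) \<le> (\<Sum>i<n. (1 + \<eta>) * v * (Z i \<omega>)\<^sup>2 + (1 + 1 / \<eta>) * (\<Delta> * K\<^sup>2))"
      "(\<Sum>i<n. (1 - \<eta>) * v * (Z i \<omega>)\<^sup>2 - (1 / \<eta> - 1) * (\<Delta> * K\<^sup>2)) \<le> (\<Sum>i<n. ?x i)"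
      by (intro sum_mono bounds; simp)+
    then have "(\<Sum>i<n. ?x i) \<le> (1 + \<eta>) * v * Q \<omega> + real n * ((1 + 1 / \<eta>) * (\<Delta> * K\<^sup>2))"
      "(1 - \<eta>) * v * Q \<omega> - real n * ((1 / \<eta> - 1) * (\<Delta> * K\<^sup>2)) \<le> (\<Sum>i<n. ?x i)"
      by (simp_all add: Q_def sum.distrib sum_subtractf mult.assoc mult.left_commute[of "real n"]
          flip: sum_distrib_left)
    from this[THEN divide_right_mono, of "real n"] show ?case
      using assms(5) by (simp add: S add_divide_distrib diff_divide_distrib)
  qed
  then show ?thesis
    using that[OF Q] by (simp add: AE_conj_iff)
qed

subsection \<open>Error probabilities of the test\<close>

text \<open>The rejection threshold is the upper bound for \<open>S_dot\<close> with
  \<open>Q\<close> replaced by its quantile of order \<open>1 - \<alpha>\<close>. The drift terms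
  therefore cancel, and rejection almost surely forces \<open>Q\<close> to reach that
  quantile.\<close>

lemma type_I_error_le:
  assumes "diffusion_law M b x0 X v0" "drift_approx M X b T A K"
    and "\<Delta> > 0" "real n * \<Delta> = T" "n \<ge> 1" "0 < \<eta>" "\<eta> < 1" "0 < v0"
    and "0 < \<alpha>" "\<alpha> < 1"
  shows "measure M {\<omega> \<in> space M. Upsilon_rejects X A \<Delta> n K v0 \<alpha> \<eta> \<omega>} \<le> \<alpha>"
proof -
  interpret prob_space M
    using assms(1) by (auto simp: diffusion_law_def brownian_motion_def)
  interpret chi: real_distribution "chi_squared n" by (rule real_distribution_chi_squared)
  obtain Q where [measurable]: "Q \<in> borel_measurable M"
    and Q: "distr M borel Q = chi_squared n"
    and S: "AE \<omega> in M. S_dot X A \<Delta> n \<omega>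
      \<le> (1 + \<eta>) * (v0 / real n) * Q \<omega> + (1 + 1 / \<eta>) * (\<Delta> * K\<^sup>2)"
    using S_dot_chi_squared_bounds[OF assms(1-7)] by blast
  let ?q = "q_chi2 n (1 - \<alpha>)"
  have pos: "0 < (1 + \<eta>) * (v0 / real n)"
    using assms by auto
  have "measure M {\<omega> \<in> space M. Upsilon_rejects X A \<Delta> n K v0 \<alpha> \<eta> \<omega>}
      \<le> measure M (Q -` {?q..} \<inter> space M)"
  proof (rule finite_measure_mono_AE)
    show "AE \<omega> in M. \<omega> \<in> {\<omega> \<in> space M. Upsilon_rejects X A \<Delta> n K v0 \<alpha> \<eta> \<omega>}
        \<longrightarrow> \<omega> \<in> Q -` {?q..} \<inter> space M"
      using S
    proof eventually_elim
      case (elim \<omega>)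
      have "(\<eta> + 1) / \<eta> * \<Delta> * K\<^sup>2 = (1 + 1 / \<eta>) * (\<Delta> * K\<^sup>2)"
        using assms(6) by (simp add: field_simps)
      with elim have "(1 + \<eta>) * (v0 / real n) * ?q \<le> (1 + \<eta>) * (v0 / real n) * Q \<omega>"
        if "Upsilon_rejects X A \<Delta> n K v0 \<alpha> \<eta> \<omega>"
        using that unfolding Upsilon_rejects_def by linarith
      then show ?case using mult_le_cancel_left_pos[OF pos] by auto
    qed
  qed simp
  also have "\<dots> = measure (chi_squared n) {?q..}"
    unfolding Q[symmetric] by (subst measure_distr) auto
  also have "\<dots> \<le> 1 - (1 - \<alpha>)"
    using assms by (intro chi.measure_atLeast_quantile_le measure_chi_squared_singleton) auto
  finally show ?thesis by simp
qed

text \<open>On acceptance, the lower bound for \<open>S_dot\<close> lies below the threshold; the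
  condition \<open>le\<close> on \<open>v\<close> is what turns this into \<open>Q\<close> <
  \<open>q_chi2 n \<beta>\<close>.\<close>

lemma type_II_error_le:
  assumes "diffusion_law M b x0 X v" "drift_approx M X b T A K"
    and "\<Delta> > 0" "real n * \<Delta> = T" "n \<ge> 1" "0 < \<eta>" "\<eta> < 1" "0 < v"
    and \<beta>: "0 < \<beta>" "\<beta> < 1"
    and le: "((1 + \<eta>) / (1 - \<eta>)) * (q_chi2 n (1 - \<alpha>) / q_chi2 n \<beta>) * v0
      + (2 / (\<eta> * (1 - \<eta>))) * (real n * \<Delta> * K\<^sup>2 / q_chi2 n \<beta>) \<le> v"
  shows "measure M {\<omega> \<in> space M. \<not> Upsilon_rejects X A \<Delta> n K v0 \<alpha> \<eta> \<omega>} \<le> \<beta>"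
proof -
  interpret prob_space M
    using assms(1) by (auto simp: diffusion_law_def brownian_motion_def)
  interpret chi: real_distribution "chi_squared n" by (rule real_distribution_chi_squared)
  obtain Q where [measurable]: "Q \<in> borel_measurable M"
    and Q: "distr M borel Q = chi_squared n"
    and S: "AE \<omega> in M. (1 - \<eta>) * (v / real n) * Q \<omega> - (1 / \<eta> - 1) * (\<Delta> * K\<^sup>2)
      \<le> S_dot X A \<Delta> n \<omega>"
    using S_dot_chi_squared_bounds[OF assms(1-7)] by blast
  let ?q = "q_chi2 n \<beta>" and ?q' = "q_chi2 n (1 - \<alpha>)"
  have q: "0 < ?q" using q_chi2_pos assms(5) \<beta> by simp
  have pos: "0 < (1 - \<eta>) * (v / real n)"
    using assms by auto
  \<comment> \<open>Multiplying \<open>le\<close> by \<open>(1 - \<eta>) / real n * ?q\<close>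
    clears its denominators.\<close>
  have "(1 + \<eta>) * (v0 / real n) * ?q' + 2 / \<eta> * (\<Delta> * K\<^sup>2)
      = (1 - \<eta>) / real n * ?q * (((1 + \<eta>) / (1 - \<eta>)) * (?q' / ?q) * v0
      + (2 / (\<eta> * (1 - \<eta>))) * (real n * \<Delta> * K\<^sup>2 / ?q))"
    using q assms(5-7) by (simp add: divide_simps)
  also have "\<dots> \<le> (1 - \<eta>) / real n * ?q * v"
    using q assms(7) by (intro mult_left_mono le) auto
  finally have thr: "(1 + \<eta>) * (v0 / real n) * ?q' + 2 / \<eta> * (\<Delta> * K\<^sup>2)
      \<le> (1 - \<eta>) * (v / real n) * ?q"
    by (simp add: algebra_simps)
  have "measure M {\<omega> \<in> space M. \<not> Upsilon_rejects X A \<Delta> n K v0 \<alpha> \<eta> \<omega>}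
      \<le> measure M (Q -` {..<?q} \<inter> space M)"
  proof (rule finite_measure_mono_AE)
    show "AE \<omega> in M. \<omega> \<in> {\<omega> \<in> space M. \<not> Upsilon_rejects X A \<Delta> n K v0 \<alpha> \<eta> \<omega>}
        \<longrightarrow> \<omega> \<in> Q -` {..<?q} \<inter> space M"
      using S
    proof eventually_elim
      case (elim \<omega>)
      \<comment> \<open>Origin of the constant 2: the drift allowance in the threshold plus the
        drift loss in the lower bound, \<open>(1 + 1 / \<eta>) + (1 / \<eta> - 1)\<close>.\<close>
      have "(\<eta> + 1) / \<eta> * \<Delta> * K\<^sup>2 + (1 / \<eta> - 1) * (\<Delta> * K\<^sup>2) = 2 / \<eta> * (\<Delta> * K\<^sup>2)"
        using assms(6) by (simp add: field_simps)
      with elim thr have "(1 - \<eta>) * (v / real n) * Q \<omega> < (1 - \<eta>) * (v / real n) * ?q"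
        if "\<not> Upsilon_rejects X A \<Delta> n K v0 \<alpha> \<eta> \<omega>"
        using that unfolding Upsilon_rejects_def by linarith
      then show ?case using mult_less_cancel_left_pos[OF pos] by auto
    qed
  qed simp
  also have "\<dots> = measure (chi_squared n) {..<?q}"
    unfolding Q[symmetric] by (subst measure_distr) auto
  also have "\<dots> \<le> \<beta>"
    by (rule chi.measure_lessThan_quantile_le[OF \<beta>])
  finally show ?thesis .
qed

text \<open>\<Theta> collects the values of the squared diffusion coefficient under consideration,
  with \<open>A\<close> and \<open>K\<close> common to all of them. As the null hypothesis is the
  single value \<open>v0\<close>, the level claim is the Type I bound.\<close>

theorem proposition4:
  fixes P :: "real \<Rightarrow> 'a measure"
    and X :: "real \<Rightarrow> 'a \<Rightarrow> real"
    and b :: "real \<Rightarrow> real"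
    and A :: "real \<Rightarrow> real \<Rightarrow> real \<Rightarrow> real"
    and \<Theta> :: "real set"
    and x0 T \<Delta> K v0 \<alpha> \<eta> :: real
    and n :: nat
  assumes "n \<ge> 1" and "\<Delta> > 0" and "real n * \<Delta> = T"
    and "\<Theta> \<subseteq> {0<..}" and "v0 \<in> \<Theta>"
    and "\<And>v. v \<in> \<Theta> \<Longrightarrow> diffusion_law (P v) b x0 X v"
    and "\<And>v. v \<in> \<Theta> \<Longrightarrow> drift_approx (P v) X b T A K"
    and "0 < \<alpha>" and "\<alpha> < 1" and "0 < \<eta>" and "\<eta> < 1"
  shows "measure (P v0) {\<omega> \<in> space (P v0). Upsilon_rejects X A \<Delta> n K v0 \<alpha> \<eta> \<omega>} \<le> \<alpha>
    \<and> of_level P {v0} (Upsilon_rejects X A \<Delta> n K v0 \<alpha> \<eta>) \<alpha>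
    \<and> (\<forall>\<beta>. 0 < \<beta> \<and> \<beta> < 1 \<and> 1 - \<beta> \<ge> \<alpha> \<longrightarrow>
         (\<forall>v\<in>\<Theta>. v \<ge> ((1 + \<eta>) / (1 - \<eta>)) * (q_chi2 n (1 - \<alpha>) / q_chi2 n \<beta>) * v0
                      + (2 / (\<eta> * (1 - \<eta>))) * (real n * \<Delta> * K\<^sup>2 / q_chi2 n \<beta>) \<longrightarrow>
            measure (P v) {\<omega> \<in> space (P v). \<not> Upsilon_rejects X A \<Delta> n K v0 \<alpha> \<eta> \<omega>} \<le> \<beta>))"
proof -
  have pos: "0 < v" if "v \<in> \<Theta>" for v
    using assms(4) that by auto
  note bounds = assms(2,3,1,10,11)
  note typeI = type_I_error_le[OF assms(6,7)[OF assms(5)] bounds pos[OF assms(5)] assms(8,9)]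
  note typeII = type_II_error_le[OF assms(6,7) bounds pos]
  show ?thesis
    using typeI typeII by (auto simp: of_level_def)
qed

end
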